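(* Let $n\geq 3$, $k\geq 1$, $a=[n,n+1,\ldots,n+k]$, $b=F_nF_{n+1}\cdots F_{n+k}$ and $f_k(n)=\frac{F_nF_{n+1}\cdots F_{n+k}}{[F_n,F_{n+1},\ldots,F_{n+k}]}$. Then: (i) $b\mid f_k(n)F_{aj}$ for every integer $j\geq 1$. (ii) $z(b)=aj$ where $j$ is the smallest positive integer such that $b\mid F_{aj}$. In fact, $j$ is the smallest positive integer such that $v_p(b)\le v_p(F_{aj})$ for every prime $p$ dividing $f_k(n)$.
   Context: $F_n$ is the $n$th Fibonacci number ($F_1=F_2=1$, $F_n=F_{n-1}+F_{n-2}$). For a positive integer $m$, $z(m)$ (the order of appearance of $m$ in the Fibonacci sequence) is the smallest positive integer $k$ with $m\mid F_k$. $[\cdots]$ denotes lcm, and $v_p$ the $p$-adic valuation. *)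

theory Defs
  imports "HOL-Number_Theory.Number_Theory"
begin

text \<open>
  The order of appearance is meaningful for \<open>m > 0\<close> only; \<^term>\<open>fib\<close> has the
  convention \<open>fib 0 = 0\<close>, so the restriction to positive indices is essential.
\<close>

definition order_of_appearance :: "nat \<Rightarrow> nat" where
  "order_of_appearance m = (LEAST k. k > 0 \<and> m dvd fib k)"

definition fib_quot :: "nat \<Rightarrow> nat \<Rightarrow> nat" where
  "fib_quot k n = (\<Prod>i\<in>{n..n+k}. fib i) div Lcm (fib ` {n..n+k})"

text \<open>The natural number division in \<^term>\<open>fib_quot\<close> is exact.\<close>

lemma fib_quot_times_Lcm:
  "fib_quot k n * Lcm (fib ` {n..n+k}) = (\<Prod>i\<in>{n..n+k}. fib i)"
proof -
  have "Lcm (fib ` {n..n+k}) dvd (\<Prod>i\<in>{n..n+k}. fib i)"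
    by (rule Lcm_least) (auto intro: dvd_prodI)
  then show ?thesis
    unfolding fib_quot_def by simp
qed

end

theory Submission
  imports Defs
begin

text \<open>
  For \<open>i \<ge> 3\<close> one has \<open>F\<^sub>i dvd F\<^sub>m\<close> iff \<open>i dvd m\<close>. Hence the lcm of
  \<open>F\<^sub>n, \<dots>, F\<^bsub>n+k\<^esub>\<close> divides \<open>F\<^bsub>aj\<^esub>\<close> for all \<open>j\<close>, and conversely any \<open>m\<close> with
  \<open>b dvd F\<^sub>m\<close> is a multiple of \<open>a\<close>. At primes not dividing \<open>f\<^sub>k(n)\<close> the numbers \<open>b\<close> and
  the lcm have the same valuation, so only the primes dividing \<open>f\<^sub>k(n)\<close> matter.
\<close>

lemma fib_dvd_fib: "m dvd n \<Longrightarrow> fib m dvd fib n"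
  by (metis fib_gcd gcd_nat.absorb_iff1)

lemma fib_less_fib:
  assumes "2 \<le> m" "m < n"
  shows "fib m < fib n"
proof -
  obtain i where i: "m = Suc (Suc i)"
    using assms(1) by (metis add_2_eq_Suc le_Suc_ex)
  \<comment> \<open>The gap is \<open>fib (Suc i)\<close>, positive because its index is at least
    1.\<close>
  have "fib m < fib (Suc m)"
    using i fib_neq_0_nat[of "Suc i"] by simp
  also have "\<dots> \<le> fib n"
    using assms(2) by (intro fib_mono) simp
  finally show ?thesis .
qed

text \<open>Since \<open>fib\<close> commutes with gcd, divisibility gives
  \<open>fib (gcd m n) = fib m\<close>, and \<open>fib\<close> takes the value \<open>fib m\<close>
  at no smaller index. This fails at 2, as \<open>fib 1 = fib 2\<close>.\<close>

lemma fib_dvd_fib_iff: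
  assumes "3 \<le> m"
  shows "fib m dvd fib n \<longleftrightarrow> m dvd n"
proof
  assume "fib m dvd fib n"
  then have eq: "fib (gcd m n) = fib m"
    by (simp add: fib_gcd gcd_nat.absorb1)
  have "gcd m n = m"
  proof (rule ccontr)
    assume "gcd m n \<noteq> m"
    moreover have "gcd m n \<le> m"
      using assms by (intro dvd_imp_le) auto
    \<comment> \<open>Strict growth starts only at index 2; below it, \<open>fib (gcd m n)\<close>
      is bounded by \<open>fib 2\<close>.\<close>
    ultimately have "gcd m n \<le> 2 \<or> (2 \<le> gcd m n \<and> gcd m n < m)"
      by linarith
    then have "fib (gcd m n) < fib m"
      using fib_mono[of "gcd m n" 2] fib_less_fib[of 2 m] fib_less_fib[of "gcd m n" m] assms
      by force
    with eq show False by simp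
  qed
  then show "m dvd n" by (metis gcd_dvd2)
qed (rule fib_dvd_fib)

text \<open>The recurrence run backwards moves the repeated pair down to \<open>i = 0\<close>, where
  \<open>fib 0 = 0\<close>.\<close>

lemma fib_cong_zero_of_repeated_pair:
  assumes "[fib i = fib (i + d)] (mod m)" "[fib (Suc i) = fib (Suc (i + d))] (mod m)"
  shows "m dvd fib d"
  using assms
proof (induction i)
  case 0
  then show ?case by (simp add: cong_def dvd_eq_mod_eq_0)
next
  case (Suc i)
  have "[fib (Suc i) + fib i = fib (Suc i + d) + fib (i + d)] (mod m)"
    using Suc.prems(2) by simp
  then have "[fib (Suc i) + fib i = fib (Suc i) + fib (i + d)] (mod m)"
    using Suc.prems(1) by (meson cong_add_rcancel_nat cong_sym cong_trans)
  then have "[fib i = fib (i + d)] (mod m)"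
    by (simp only: cong_add_lcancel_nat)
  then show ?case
    using Suc.IH Suc.prems(1) by simp
qed

text \<open>Pigeonhole on the pairs of consecutive Fibonacci numbers modulo \<open>m\<close>.\<close>
lemma ex_dvd_fib:
  assumes "m > 0"
  shows "\<exists>d>0. m dvd fib d"
proof -
  let ?g = "\<lambda>i. (fib i mod m, fib (Suc i) mod m)"
  have "range ?g \<subseteq> {..<m} \<times> {..<m}"
    using assms by auto
  then have "finite (range ?g)"
    by (rule finite_subset) simp
  then have "\<not> inj ?g"
    using finite_imageD infinite_UNIV_nat by blast
  then obtain i j where "i < j" "?g i = ?g j"
    unfolding inj_def by (metis linorder_neqE_nat)
  then have "m dvd fib (j - i)"
    by (intro fib_cong_zero_of_repeated_pair[of i]) (auto simp: cong_def)
  with \<open>i < j\<close> show ?thesis by (intro exI[of _ "j - i"]) simp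
qed

lemma dvd_of_multiplicity_le_at_cofactor_primes:
  fixes b f L x :: nat
  assumes "f * L = b" "L dvd x" "b > 0" "x > 0"
    and "\<And>p. prime p \<Longrightarrow> p dvd f \<Longrightarrow> multiplicity p b \<le> multiplicity p x"
  shows "b dvd x"
proof (rule multiplicity_le_imp_dvd)
  fix p :: nat
  assume p: "prime p"
  show "multiplicity p b \<le> multiplicity p x"
  proof (cases "p dvd f")
    case False
    then have "multiplicity p b = multiplicity p L"
      using assms(1,3) p by (auto simp: prime_elem_multiplicity_mult_distrib not_dvd_imp_multiplicity_0)
    also have "\<dots> \<le> multiplicity p x"
      using assms(2,4) by (intro dvd_imp_multiplicity_le) auto
    finally show ?thesis .
  qed (use assms(5) p in auto)
qed (use assms(3) in auto)

theorem theorem3p1: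
  fixes n k a b :: nat
  assumes n: "n \<ge> 3"
    and k: "k \<ge> 1"
    and a: "a = Lcm {n..n+k}"
    and b: "b = (\<Prod>i\<in>{n..n+k}. fib i)"
  shows "(\<forall>j\<ge>1. b dvd fib_quot k n * fib (a * j)) \<and>
    (\<exists>j\<ge>1.
      (b dvd fib (a * j) \<and> (\<forall>i\<ge>1. b dvd fib (a * i) \<longrightarrow> j \<le> i)) \<and>
      order_of_appearance b = a * j \<and>
      ((\<forall>p. prime p \<and> p dvd fib_quot k n \<longrightarrow>
          multiplicity p b \<le> multiplicity p (fib (a * j))) \<and>
       (\<forall>i\<ge>1. (\<forall>p. prime p \<and> p dvd fib_quot k n \<longrightarrow>
          multiplicity p b \<le> multiplicity p (fib (a * i))) \<longrightarrow> j \<le> i)))"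
proof -
  let ?f = "fib_quot k n" and ?L = "Lcm (fib ` {n..n+k})"
  have fL: "?f * ?L = b"
    using b fib_quot_times_Lcm by simp
  have b_pos: "b > 0"
    using n b by (auto intro!: prod_pos fib_neq_0_nat)
  have "a \<noteq> 0"
    using n a by (auto simp: Lcm_0_iff)
  then have a_pos: "a > 0" by simp
  have L_dvd: "?L dvd fib (a * j)" for j
    using a by (auto intro!: Lcm_least fib_dvd_fib dvd_mult2 dvd_Lcm)
  have a_dvd: "a dvd m" if "b dvd fib m" for m
    unfolding a
  proof (rule Lcm_least)
    fix i assume i: "i \<in> {n..n+k}"
    then have "fib i dvd b" unfolding b by (intro dvd_prodI) auto
    then show "i dvd m"
      using that i n fib_dvd_fib_iff[of i m] by (auto intro: dvd_trans)
  qed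
  have primes_iff: "b dvd fib (a * j) \<longleftrightarrow>
      (\<forall>p. prime p \<and> p dvd ?f \<longrightarrow> multiplicity p b \<le> multiplicity p (fib (a * j)))"
    if "j \<ge> 1" for j
  proof -
    \<comment> \<open>Positivity matters: \<open>multiplicity p 0\<close> is 0 by convention,
      although everything divides 0.\<close>
    have "fib (a * j) > 0"
      using that a_pos by (intro fib_neq_0_nat) simp
    then show ?thesis
      using dvd_of_multiplicity_le_at_cofactor_primes[OF fL L_dvd b_pos]
      by (auto intro: dvd_imp_multiplicity_le)
  qed
  define z where "z = order_of_appearance b"
  have z: "z > 0" "b dvd fib z"
    using LeastI_ex[OF ex_dvd_fib[OF b_pos]] by (simp_all add: z_def order_of_appearance_def)
  have z_le: "z \<le> m" if "m > 0" "b dvd fib m" for m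
    using that by (simp add: z_def order_of_appearance_def Least_le)
  \<comment> \<open>The witness is the cofactor of \<open>a\<close> in \<open>z\<close>; cancelling
    \<open>a\<close> turns minimality of \<open>z\<close> into minimality of
    \<open>j\<close>.\<close>
  obtain j where j: "z = a * j"
    using a_dvd[OF z(2)] by (rule dvdE)
  have j1: "j \<ge> 1"
    using z(1) j by (cases j) auto
  have least: "j \<le> i" if "i \<ge> 1" "b dvd fib (a * i)" for i
    using z_le[of "a * i"] that a_pos j by simp
  \<comment> \<open>Part (i): write \<open>b\<close> as \<open>?f * ?L\<close> and use that
    \<open>?L\<close> divides \<open>fib (a * i)\<close>.\<close>
  have "b dvd ?f * fib (a * i)" for i
    unfolding fL[symmetric] by (intro mult_dvd_mono L_dvd) simp
  moreover have "b dvd fib (a * j)" "order_of_appearance b = a * j"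
    using z(2) j by (simp_all add: z_def)
  ultimately show ?thesis
    using j1 least primes_iff by blast
qed

end
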